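(* For every integer $k\ge 1$ let $S_k:=(0,2,2^2,2^3,\dots,2^{2k},0)$ (a tuple of length $2k+2$). Then for every integer $k\ge 1$ we have $S_k\mapsto S_{k+1}$, and exactly one Overflow rule is applied in passing from $S_k$ to $S_{k+1}$. Consequently the process started at $(0,2,4,0)=S_1$ never halts: $P^j(S_1)$ is defined for every $j\ge 0$.
   Context: A state is a finite tuple of integers $S=(a_\ell,a_{\ell-1},\dots,a_1,a_0)$ with $\ell\ge 0$; $a_i$ is the $i$-th index of $S$ (indices counted from the right, starting at $0$). The successor $P(S)$ is defined by the following rules, which are mutually exclusive. (Overflow) If $a_\ell$ is odd and $a_{\ell-1},\dots,a_0$ are all even, then $P(S)=(0,a_\ell+1,a_{\ell-1},\dots,a_0)$. (Halt) If all entries are even and $a_\ell=a_{\ell-1}=0$, the process halts and $P(S)$ is undefined. (Zero) If all entries are even and $(a_\ell,a_{\ell-1})\neq(0,0)$, then $P(S)=(0,0,a_\ell+1,a_{\ell-1},\dots,a_1,a_0-1)$. (Halve) If $a_0=-1$, then $P(S)=(a_\ell,\dots,a_1)$ (the last entry is deleted). (Increment) In every other case, let $i$ be the smallest index with $a_i$ odd and set $P(S)=(a_\ell,\dots,a_{i+2},a_{i+1}+1,a_i,\dots,a_1,a_0-1)$. Write $S\mapsto T$ if $T=P^j(S)$ for some integer $j\ge 0$ (all intermediate states being defined); the rules applied in passing from $S$ to $T$ are those applied at $S,P(S),\dots,P^{j-1}(S)$. (This process describes the 5-state Turing machine known as Skelet #17.) *)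

theory Defs
  imports Main
begin

text \<open>
  A state \<open>(a\<^sub>l, \<dots>, a\<^sub>1, a\<^sub>0)\<close> is represented by a nonempty list in
  reading order, so that \<open>hd S\<close> is the entry of index \<open>l = length S - 1\<close> and
  \<open>last S\<close> is the entry of index \<open>0\<close>.
\<close>

type_synonym state = "int list"

text \<open>The \<open>i\<close>-th index of a state, counted from the right starting at \<open>0\<close>.\<close>

definition entry :: "state \<Rightarrow> nat \<Rightarrow> int" where
  "entry S i = S ! (length S - 1 - i)"

datatype rule = Overflow | Halt | Zero | Halve | Increment

text \<open>
  The conditions of the rules overlap or become meaningless only for one-entry
  states, where the following conventions are used. The state \<open>(-1)\<close> is subject to
  Overflow, since deleting its only entry would not leave a state. On a state consisting
  of a single even entry there is no \<open>a\<^bsub>l-1\<^esub>\<close>, and Zero would prescribe two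
  different values for the same entry; the successor is therefore left undefined. The
  empty list, which is not a state, has no successor either.
\<close>

definition rule_at :: "state \<Rightarrow> rule" where
  "rule_at S =
     (if S \<noteq> [] \<and> odd (hd S) \<and> (\<forall>x \<in> set (tl S). even x) then Overflow
      else if \<forall>x \<in> set S. even x then
        (if length S \<le> 1 \<or> (S ! 0 = 0 \<and> S ! 1 = 0) then Halt else Zero)
      else if last S = -1 then Halve
      else Increment)"

definition first_odd :: "state \<Rightarrow> nat" where
  "first_odd S = (LEAST i. i < length S \<and> odd (entry S i))"

text \<open>
  In the Increment case the index \<open>i = first_odd S\<close> is smaller than \<open>l\<close>
  (otherwise Overflow applies), so the list position \<open>l - (i + 1)\<close> of the entry
  \<open>a\<^bsub>i+1\<^esub>\<close> is not truncated and differs from the position \<open>l\<close> of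
  \<open>a\<^sub>0\<close>.
\<close>

definition successor :: "state \<Rightarrow> state option" where
  "successor S =
     (case rule_at S of
        Overflow \<Rightarrow> Some (0 # (hd S + 1) # tl S)
      | Halt \<Rightarrow> None
      | Zero \<Rightarrow> Some (0 # 0 # (hd S + 1) # butlast (tl S) @ [last S - 1])
      | Halve \<Rightarrow> Some (butlast S)
      | Increment \<Rightarrow>
          (let l = length S - 1; i = first_odd S
           in Some (S[l - (i + 1) := entry S (i + 1) + 1, l := entry S 0 - 1])))"

primrec iterate :: "nat \<Rightarrow> state \<Rightarrow> state option" where
  "iterate 0 S = Some S"
| "iterate (Suc j) S = Option.bind (iterate j S) successor"

definition leads_to :: "state \<Rightarrow> state \<Rightarrow> bool" (infix "\<mapsto>" 50) where
  "S \<mapsto> T \<longleftrightarrow> (\<exists>j. iterate j S = Some T)"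

text \<open>
  The rules applied at \<open>S, P(S), \<dots>, P\<^bsup>j-1\<^esup>(S)\<close>; meaningful only if
  \<open>iterate j S\<close> is defined.
\<close>

definition rules_applied :: "nat \<Rightarrow> state \<Rightarrow> rule list" where
  "rules_applied j S = map (\<lambda>i. rule_at (the (iterate i S))) [0..<j]"

definition S_state :: "nat \<Rightarrow> state" where
  "S_state k = 0 # map (\<lambda>i. 2 ^ i) [1..<2 * k + 1] @ [0]"

end

theory Submission
  imports Defs "HOL-Computational_Algebra.Primes"
begin

text \<open>
  Apart from \<open>a\<^sub>0\<close>, the parities of the entries of a state form the reflected Gray code of a number
  \<open>n\<close>. Increment changes \<open>n\<close> by one, upwards if the sum of all entries is odd and
  downwards if it is even, and it adds 1 to the entry whose bit flips. A run of Increments therefore has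
  a closed form in terms of the number of flips of each bit between \<open>0\<close> and \<open>n\<close>.

  From an all-even state \<open>2 f\<close> the process applies Zero and Halve, runs upwards, applies Halve again
  and runs down to the next all-even state \<open>2 f'\<close>. On the states met here, \<open>f'\<close> is \<open>f\<close> with
  a single entry \<open>p\<close> raised by 1, and \<open>p\<close> then moves to \<open>p - 2\<close>, or, once an entry
  0 or 1 has been raised, to a position given by the 2-adic valuation \<open>v2\<close> of the new value. Only the entries
  \<open>f 0 = h\<close> and \<open>f 1 = 2\<^bsup>l-2\<^esup> + g\<close> matter for this: \<open>g\<close> and \<open>h\<close> take turns in
  running to the next number of odd valuation, until \<open>g = 2\<^bsup>l-1\<^esup>\<close> and
  \<open>h = 2\<^bsup>l-1\<^esup> - 2\<close>. At that point \<open>f\<close> is a fixed point of the cycle map, which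
  determines all its entries, and the next upward run overflows. Two more descents of \<open>p\<close> lead to
  \<open>S\<^bsub>k+1\<^esub>\<close>.

  The passage cannot be repeated, since the lengths of the states reached are unbounded.
\<close>

section \<open>States as functions of the index, and the rules on them\<close>

text \<open>Counting indices from the right makes Halve a shift by one, and lets Zero and Overflow
  add leading entries without renumbering the others.\<close>

definition state_of :: "nat \<Rightarrow> (nat \<Rightarrow> int) \<Rightarrow> state" where
  "state_of L a = rev (map a [0..<Suc L])"

lemma length_state_of [simp]: "length (state_of L a) = Suc L"
  by (simp add: state_of_def)

lemma state_of_Suc: "state_of (Suc L) a = a (Suc L) # state_of L a"
  by (simp add: state_of_def)

lemma nth_state_of: "i \<le> L \<Longrightarrow> state_of L a ! i = a (L - i)"
  unfolding state_of_def by (subst rev_nth) (auto simp del: upt_Suc)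

lemma entry_state_of [simp]: "i \<le> L \<Longrightarrow> entry (state_of L a) i = a i"
  by (simp add: entry_def nth_state_of)

lemma state_of_nonempty [simp]: "state_of L a \<noteq> []"
  by (metis length_state_of length_0_conv nat.distinct(1))

lemma hd_state_of [simp]: "hd (state_of L a) = a L"
  by (simp add: hd_conv_nth nth_state_of)

lemma last_state_of [simp]: "last (state_of L a) = a 0"
  by (simp add: last_conv_nth nth_state_of)

lemma tl_state_of [simp]: "tl (state_of (Suc L) a) = state_of L a"
  by (simp add: state_of_Suc)

lemma set_state_of [simp]: "set (state_of L a) = a ` {..L}"
  by (auto simp: state_of_def simp del: upt_Suc)

lemma butlast_state_of: "butlast (state_of (Suc L) a) = state_of L (\<lambda>i. a (Suc i))"
  by (rule nth_equalityI) (auto simp: nth_butlast nth_state_of Suc_diff_le)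

lemma state_of_cong: "(\<And>i. i \<le> L \<Longrightarrow> a i = b i) \<Longrightarrow> state_of L a = state_of L b"
  by (simp add: state_of_def)

lemma rule_at_state_of:
  assumes "L > 0"
  shows "rule_at (state_of L a) =
    (if odd (a L) \<and> (\<forall>i<L. even (a i)) then Overflow
     else if \<forall>i\<le>L. even (a i) then (if a L = 0 \<and> a (L - 1) = 0 then Halt else Zero)
     else if a 0 = -1 then Halve else Increment)"
proof -
  obtain L' where L: "L = Suc L'"
    using assms by (cases L) auto
  show ?thesis
    unfolding rule_at_def using nth_state_of[of 0 L a] nth_state_of[of 1 L a]
    by (auto simp: L less_Suc_eq_le)
qed

text \<open>Runs are collected in the closure of \<open>quiet\<close>, so an Overflow can never hide
  in one and the single Overflow is counted separately.\<close>

definition quiet :: "state \<Rightarrow> state \<Rightarrow> bool" where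
  "quiet S T \<longleftrightarrow> successor S = Some T \<and> rule_at S \<noteq> Overflow"

lemma quiet_increment:
  assumes r: "r < L" and odd: "odd (a r)" and even: "\<And>i. i < r \<Longrightarrow> even (a i)" and a0: "a 0 \<noteq> -1"
  shows "quiet (state_of L a) (state_of L (a(Suc r := a (Suc r) + 1, 0 := a 0 - 1)))"
proof -
  have rule: "rule_at (state_of L a) = Increment"
    using r odd a0 by (auto simp: rule_at_state_of intro!: exI[of _ r])
  have first: "first_odd (state_of L a) = r"
    unfolding first_odd_def
  proof (rule Least_equality)
    show "r < length (state_of L a) \<and> odd (entry (state_of L a) r)"
      using r odd by simp
    show "r \<le> i" if "i < length (state_of L a) \<and> odd (entry (state_of L a) i)" for i
      using that even[of i] by (metis entry_state_of length_state_of less_Suc_eq_le not_le)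
  qed
  have "(state_of L a)[L - (r + 1) := a (Suc r) + 1, L := a 0 - 1]
      = state_of L (a(Suc r := a (Suc r) + 1, 0 := a 0 - 1))"
    using r by (intro nth_equalityI) (auto simp: nth_list_update nth_state_of)
  thus ?thesis
    using r by (simp add: quiet_def rule successor_def first Let_def)
qed

lemma quiet_halve:
  assumes "a 0 = -1"
  shows "quiet (state_of (Suc L) a) (state_of L (\<lambda>i. a (Suc i)))"
proof -
  have "rule_at (state_of (Suc L) a) = Halve"
    using assms by (auto simp: rule_at_state_of)
  thus ?thesis
    by (simp add: quiet_def successor_def butlast_state_of)
qed

lemma quiet_zero:
  assumes L: "L > 0" and even: "\<And>i. i \<le> L \<Longrightarrow> even (a i)" and nz: "a (L - 1) \<noteq> 0"
  shows "quiet (state_of L a)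
    (state_of (Suc (Suc L)) (a(0 := a 0 - 1, L := a L + 1, Suc L := 0, Suc (Suc L) := 0)))"
proof -
  obtain L' where L': "L = Suc L'"
    using L by (cases L) auto
  have "rule_at (state_of L a) = Zero"
    using assms by (auto simp: rule_at_state_of)
  moreover have "butlast (state_of L' a) @ [a 0 - 1] = state_of L' (a(0 := a 0 - 1))"
    by (rule nth_equalityI) (auto simp: nth_append nth_butlast nth_state_of)
  moreover have "state_of L' (a(0 := a 0 - 1)) = state_of L' (a(0 := a 0 - 1, L := a L + 1, Suc L := 0, Suc (Suc L) := 0))"
    by (rule state_of_cong) (auto simp: L')
  ultimately show ?thesis
    by (simp add: quiet_def successor_def L' state_of_Suc)
qed

lemma overflow:
  assumes "L > 0" "odd (a L)" "\<And>i. i < L \<Longrightarrow> even (a i)"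
  shows "rule_at (state_of L a) = Overflow"
    and "successor (state_of L a) = Some (state_of (Suc L) (a(L := a L + 1, Suc L := 0)))"
proof -
  obtain L' where L': "L = Suc L'"
    using assms(1) by (cases L) auto
  show rule: "rule_at (state_of L a) = Overflow"
    using assms by (auto simp: rule_at_state_of)
  have "state_of L' a = state_of L' (a(L := a L + 1, Suc L := 0))"
    by (rule state_of_cong) (auto simp: L')
  thus "successor (state_of L a) = Some (state_of (Suc L) (a(L := a L + 1, Suc L := 0)))"
    using rule by (simp add: successor_def L' state_of_Suc)
qed

section \<open>Gray code and 2-adic valuation\<close>

text \<open>The number of flips of bit \<open>j\<close> of the Gray code in counting from \<open>0\<close> to \<open>n\<close>.\<close>

definition flips :: "nat \<Rightarrow> int \<Rightarrow> int" where
  "flips j n = (n + 2 ^ j) div 2 ^ Suc j"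


lemma flips_zero_arg [simp]: "flips j 0 = 0"
  by (simp add: flips_def)

lemma div_diff_one:
  fixes m d :: int
  assumes "d > 0"
  shows "m div d = (m - 1) div d + of_bool (d dvd m)"
proof (cases "d dvd m")
  case True
  then obtain q where q: "m = d * q" ..
  have "(m - 1) div d = q - 1"
    by (rule int_div_pos_eq[of _ _ _ "d - 1"]) (use assms in \<open>auto simp: q algebra_simps\<close>)
  thus ?thesis using assms q by simp
next
  case False
  hence "m mod d \<noteq> 0" by (simp add: dvd_eq_mod_eq_0)
  hence "m mod d > 0" using assms by (simp add: order_less_le)
  moreover have "m mod d < d" using assms by simp
  moreover have "m - 1 = d * (m div d) + (m mod d - 1)" by simp
  ultimately have "(m - 1) div d = m div d"
    by (intro int_div_pos_eq[of _ _ _ "m mod d - 1"]) auto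
  thus ?thesis using False by simp
qed

definition v2 :: "int \<Rightarrow> nat" where
  "v2 n = multiplicity 2 n"

lemma v2_decompose:
  assumes "n \<noteq> 0"
  obtains t where "n = 2 ^ v2 n * (2 * t + 1)"
proof -
  obtain y where y: "n = 2 ^ v2 n * y" "\<not> 2 dvd y"
    unfolding v2_def by (rule multiplicity_decompose'[of n 2]) (use assms in auto)
  thus ?thesis using that by (metis oddE)
qed

lemma v2_eqI:
  assumes "n = 2 ^ r * y" "odd y"
  shows "v2 n = r"
  unfolding v2_def using assms by (intro multiplicity_eqI) auto

text \<open>The quotient in \<open>flips\<close> grows at \<open>n\<close> exactly when
  \<open>2 ^ Suc j\<close> divides \<open>n + 2 ^ j\<close>, that is, when \<open>n\<close> is an
  odd multiple of \<open>2 ^ j\<close>.\<close>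

lemma flips_diff:
  assumes "n \<noteq> 0"
  shows "flips j n = flips j (n - 1) + of_bool (j = v2 n)"
proof -
  have "(2 ^ Suc j dvd n + 2 ^ j) \<longleftrightarrow> j = v2 n"
  proof -
    obtain t where t: "n = 2 ^ v2 n * (2 * t + 1)"
      using assms by (rule v2_decompose)
    consider (lt) d where "v2 n = Suc j + d" | (eq) "j = v2 n" | (gt) d where "j = Suc (v2 n + d)"
      using less_iff_Suc_add[of j "v2 n"] less_iff_Suc_add[of "v2 n" j] by force
    thus ?thesis
    proof cases
      case lt
      have "n + 2 ^ j = 2 ^ j * (2 * (2 ^ d * (2 * t + 1)) + 1)"
        by (subst t) (simp add: lt power_add algebra_simps)
      moreover have "\<not> 2 ^ Suc j dvd 2 ^ j * (2 * (2 ^ d * (2 * t + 1)) + 1 :: int)"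
        by (simp add: power_Suc2 del: power_Suc)
      ultimately show ?thesis using lt by simp
    next
      case eq
      have "n + 2 ^ j = 2 ^ Suc j * (t + 1)"
        by (subst t) (simp add: eq algebra_simps)
      hence "2 ^ Suc j dvd n + 2 ^ j" by (rule dvdI)
      thus ?thesis using eq by blast
    next
      case gt
      have "n + 2 ^ j = 2 ^ v2 n * (2 * (t + 2 ^ d) + 1)"
        by (subst t) (simp add: gt power_add algebra_simps)
      hence "\<not> 2 ^ Suc (v2 n) dvd n + 2 ^ j"
        by (simp add: power_Suc2 del: power_Suc)
      moreover have "(2::int) ^ Suc (v2 n) dvd 2 ^ Suc j"
        by (rule le_imp_power_dvd) (simp add: gt)
      ultimately have "\<not> 2 ^ Suc j dvd n + 2 ^ j"
        using dvd_trans by blast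
      thus ?thesis using gt by simp
    qed
  qed
  thus ?thesis
    using div_diff_one[of "2 ^ Suc j" "n + 2 ^ j"] by (simp add: flips_def diff_add_eq)
qed

text \<open>For even \<open>n\<close> the lowest set bit of the Gray code is
  \<open>v2 n - 1\<close>, which sits in entry \<open>v2 n\<close>; for odd \<open>n\<close> the
  last entry is odd. Either way \<open>v2 n\<close> is the first odd index, so Increment raises the
  entry of the bit that flips.\<close>

lemma flips_below_v2:
  assumes "n \<noteq> 0" "j < v2 n"
  shows "even (flips j n) \<longleftrightarrow> Suc j \<noteq> v2 n"
proof -
  obtain t where t: "n = 2 ^ v2 n * (2 * t + 1)"
    using assms(1) by (rule v2_decompose)
  obtain d where d: "v2 n = Suc j + d"
    using assms(2) less_iff_Suc_add by auto
  have "flips j n = 2 ^ d * (2 * t + 1)"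
    unfolding flips_def
    by (rule int_div_pos_eq[of _ _ _ "2 ^ j"]) (subst t, auto simp: d power_add)
  thus ?thesis by (simp add: d)
qed

lemma v2_less:
  assumes "0 < n" "n < 2 ^ m"
  shows "v2 n < m"
proof -
  have "2 ^ v2 n dvd n" by (simp add: v2_def multiplicity_dvd)
  hence "(2::int) ^ v2 n \<le> n" using assms by (intro zdvd_imp_le)
  hence "(2::int) ^ v2 n < 2 ^ m" using assms by linarith
  thus ?thesis by simp
qed

section \<open>Runs of Increments\<close>

text \<open>The offset \<open>b\<close> will be even, so that the parities of the entries are those of the flip counts.\<close>

definition up :: "nat \<Rightarrow> int \<Rightarrow> (nat \<Rightarrow> int) \<Rightarrow> int \<Rightarrow> state" where
  "up L s b n = state_of L (\<lambda>i. if i = 0 then s - n else b i + flips (i - 1) n)"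

definition down :: "nat \<Rightarrow> int \<Rightarrow> (nat \<Rightarrow> int) \<Rightarrow> int \<Rightarrow> state" where
  "down L s b n = state_of L (\<lambda>i. if i = 0 then s + n else b i - flips (i - 1) n)"

lemma v2_zero_iff: "n \<noteq> 0 \<Longrightarrow> v2 n = 0 \<longleftrightarrow> odd n"
  by (simp add: v2_def multiplicity_eq_zero_iff)

lemma quiet_down:
  assumes s: "even s" and b: "\<And>i. even (b i)" and n: "0 < n" "n < 2 ^ L" and a0: "s + n \<noteq> -1"
  shows "quiet (down L s b n) (down L s b (n - 1))"
proof -
  let ?a = "\<lambda>i. if i = 0 then s + n else b i - flips (i - 1) n"
  have r: "v2 n < L" using n by (rule v2_less)
  have "quiet (state_of L ?a) (state_of L (?a(Suc (v2 n) := ?a (Suc (v2 n)) + 1, 0 := ?a 0 - 1)))"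
  proof (rule quiet_increment[OF r])
    show "odd (?a (v2 n))"
      using n s b[of "v2 n"] flips_below_v2[of n "v2 n - 1"] v2_zero_iff[of n] by auto
    show "even (?a i)" if "i < v2 n" for i
      using that n s b[of i] flips_below_v2[of n "i - 1"] v2_zero_iff[of n] by auto
  qed (use a0 in auto)
  also have "state_of L (?a(Suc (v2 n) := ?a (Suc (v2 n)) + 1, 0 := ?a 0 - 1)) = down L s b (n - 1)"
    unfolding down_def using n by (intro state_of_cong) (auto simp: flips_diff[of n])
  finally show ?thesis by (simp add: down_def)
qed

text \<open>The bits below \<open>v2 n\<close> have the same counts at \<open>n - 1\<close> as at
  \<open>n\<close>, and with \<open>s\<close> odd the last entry \<open>s - (n - 1)\<close> is odd
  exactly for odd \<open>n\<close>. So the first odd index is again \<open>v2 n\<close>.\<close>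

lemma quiet_up:
  assumes s: "odd s" and b: "\<And>i. even (b i)" and n: "0 < n" "n < 2 ^ L" and a0: "s - n \<noteq> -2"
  shows "quiet (up L s b (n - 1)) (up L s b n)"
proof -
  let ?a = "\<lambda>i. if i = 0 then s - (n - 1) else b i + flips (i - 1) (n - 1)"
  have flips: "flips j (n - 1) = flips j n - of_bool (j = v2 n)" for j
    using flips_diff[of n j] n by simp
  have r: "v2 n < L" using n by (rule v2_less)
  have "quiet (state_of L ?a) (state_of L (?a(Suc (v2 n) := ?a (Suc (v2 n)) + 1, 0 := ?a 0 - 1)))"
  proof (rule quiet_increment[OF r])
    show "odd (?a (v2 n))"
      using n s b[of "v2 n"] flips_below_v2[of n "v2 n - 1"] v2_zero_iff[of n] by (auto simp: flips)
    show "even (?a i)" if "i < v2 n" for i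
      using that n s b[of i] flips_below_v2[of n "i - 1"] v2_zero_iff[of n] by (auto simp: flips)
  qed (use a0 in auto)
  also have "state_of L (?a(Suc (v2 n) := ?a (Suc (v2 n)) + 1, 0 := ?a 0 - 1)) = up L s b n"
    unfolding up_def using n by (intro state_of_cong) (auto simp: flips)
  finally show ?thesis by (simp add: up_def)
qed

text \<open>The bound on \<open>s + n'\<close> allows the run to end at last entry -1, where Halve
  takes over, but not to pass it.\<close>

lemma down_run:
  assumes s: "even s" and b: "\<And>i. even (b i)" and n: "0 \<le> n'" "n' \<le> n" "n < 2 ^ L"
    and a0: "s + n' \<ge> -1"
  shows "quiet\<^sup>*\<^sup>* (down L s b n) (down L s b n')"
  using n(2,3)
proof (induction n rule: int_ge_induct)
  case base
  show ?case by simp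
next
  case (step m)
  have "quiet (down L s b (m + 1)) (down L s b m)"
    using quiet_down[OF s b, of "m + 1"] step n a0 by simp
  thus ?case using step by (simp add: converse_rtranclp_into_rtranclp)
qed

lemma up_run:
  assumes s: "odd s" and b: "\<And>i. even (b i)" and n: "0 \<le> n" "n \<le> n'" "n' < 2 ^ L"
    and a0: "n' \<le> s + 1"
  shows "quiet\<^sup>*\<^sup>* (up L s b n) (up L s b n')"
  using n(2,3) a0
proof (induction n' rule: int_ge_induct)
  case base
  show ?case by simp
next
  case (step m)
  have "quiet (up L s b m) (up L s b (m + 1))"
    using quiet_up[OF s b, of "m + 1"] step n by simp
  thus ?case using step by (simp add: rtranclp.rtrancl_into_rtrancl)
qed

section \<open>Flip counts under halving and at powers of two\<close>

lemma flips_eq_0: "0 \<le> n \<Longrightarrow> n < 2 ^ j \<Longrightarrow> flips j n = 0"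
  by (simp add: flips_def)

text \<open>Halve turns entry \<open>i + 1\<close> into entry \<open>i\<close>, so bits move down by
  one and the number is halved with rounding down. The count of bit 0 goes into the new last
  entry.\<close>

lemma flips_even: "flips (Suc i) (2 * n) = flips i n"
proof -
  have "2 * n + 2 ^ Suc i = 2 * (n + 2 ^ i)" by simp
  thus ?thesis unfolding flips_def by (metis div_mult_mult1 power_Suc zero_neq_numeral)
qed

lemma flips_odd: "flips (Suc i) (2 * n + 1) = flips i n"
proof -
  have "odd (2 * n + 1)" by simp
  hence "v2 (2 * n + 1) = 0" by (subst v2_zero_iff) (auto, presburger)
  thus ?thesis using flips_diff[of "2 * n + 1" "Suc i"] flips_even[of i n] by (auto, presburger)
qed

lemma flips_0_even: "flips 0 (2 * n) = n"
  by (simp add: flips_def)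

lemma flips_0_odd: "flips 0 (2 * n + 1) = n + 1"
  by (simp add: flips_def)

text \<open>The Gray code of \<open>2 ^ m - 1\<close> has bit \<open>m - 1\<close> as its only set
  bit. Such a number occurs right after Zero and right before Overflow.\<close>

lemma flips_pow2_minus_1: "flips j (2 ^ m - 1) = (if j < m then 2 ^ (m - 1 - j) else 0)"
proof (cases "j < m")
  case True
  then obtain d where d: "m = Suc (j + d)"
    using less_iff_Suc_add by auto
  have "flips j (2 ^ m - 1) = 2 ^ d"
    unfolding flips_def
    by (rule int_div_pos_eq[of _ _ _ "2 ^ j - 1"]) (auto simp: d power_add intro: order.strict_trans[of _ 0])
  thus ?thesis by (simp add: d)
next
  case False
  hence "(2::int) ^ m \<le> 2 ^ j" by (simp add: power_increasing)
  moreover have "(0::int) < 2 ^ m" by simp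
  ultimately have "flips j (2 ^ m - 1) = 0" by (intro flips_eq_0) linarith+
  thus ?thesis using False by simp
qed

lemma v2_pow2 [simp]: "v2 (2 ^ m) = m"
  by (rule v2_eqI[of _ _ 1]) auto

lemma flips_pow2: "flips j (2 ^ m) = (if j < m then 2 ^ (m - 1 - j) else of_bool (j = m))"
  using flips_diff[of "2 ^ m" j] by (simp add: flips_pow2_minus_1)

section \<open>The cycle between all-even states\<close>

text \<open>Half of what Zero contributes to entry \<open>i\<close>: its own increment of entry \<open>l\<close> plus the flips of the Gray code
  from \<open>0\<close> to \<open>2\<^bsup>l\<^esup> - 1\<close>.\<close>

definition half_flips :: "nat \<Rightarrow> nat \<Rightarrow> int" where
  "half_flips l i = (if i < l then 2 ^ (l - 1 - i) else of_bool (i = l))"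

text \<open>The effect on \<open>f\<close> of a full cycle, from the all-even state \<open>2 f\<close> to the next all-even state.\<close>

definition half_next :: "nat \<Rightarrow> (nat \<Rightarrow> int) \<Rightarrow> nat \<Rightarrow> int" where
  "half_next l f i = f (i + 2) + half_flips l (i + 2) - flips i (2 ^ (l - 1) - 1 - f 0)
     + (if i = 0 then 0 else flips (i - 1) (2 ^ (l - 2) + f 1))"

text \<open>The offset of the upward run between the two applications of Halve in a cycle.\<close>

definition half_cycle :: "nat \<Rightarrow> (nat \<Rightarrow> int) \<Rightarrow> nat \<Rightarrow> int" where
  "half_cycle l f i = 2 * (f (Suc i) + half_flips l (Suc i) - flips (i - 1) (2 ^ (l - 1) - 1 - f 0))"

text \<open>After Zero only the entries 0 and \<open>l\<close> are odd, so the number is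
  \<open>2 ^ l - 1\<close>. The last entry becomes -1 at \<open>2 * m + 1\<close> with
  \<open>m = 2 ^ (l - 1) - 1 - f 0\<close>, and Halve leaves \<open>m\<close>. The new last entry is
  \<open>s - m\<close> with \<open>s\<close> odd, so the next run goes upwards.\<close>

lemma reach_half_cycle:
  assumes l: "l \<ge> 2" and f: "\<And>i. i > l \<Longrightarrow> f i = 0" "f (l - 1) \<noteq> 0"
    and f0: "0 \<le> f 0" "f 0 < 2 ^ (l - 1)" and f1: "0 \<le> f 1"
  shows "quiet\<^sup>*\<^sup>* (state_of l (\<lambda>i. 2 * f i))
    (up (Suc l) (2 ^ (l - 1) + 2 * f 1 - 1) (half_cycle l f) (2 ^ (l - 1) - 1 - f 0))"
proof -
  let ?b = "\<lambda>i. 2 * (f i + half_flips l i)"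
  let ?m = "2 ^ (l - 1) - 1 - f 0"
  have pow: "(2::int) ^ l = 2 * 2 ^ (l - 1)"
    using l by (simp flip: power_Suc)
  \<comment> \<open>With offset \<open>?b\<close>, this makes the downward state at
    \<open>2 ^ l - 1\<close> the one produced by Zero.\<close>
  have CK: "flips i (2 ^ l - 1) = 2 * half_flips l (Suc i) - of_bool (Suc i = l)" for i
  proof (cases "Suc i < l")
    case True
    then obtain d where "l = Suc (Suc i + d)" using less_iff_Suc_add by blast
    thus ?thesis by (simp add: flips_pow2_minus_1 half_flips_def del: power_Suc) simp
  qed (auto simp: flips_pow2_minus_1 half_flips_def)
  have "quiet (state_of l (\<lambda>i. 2 * f i)) (down (Suc (Suc l)) (2 * f 0 - 2 ^ l) ?b (2 ^ l - 1))"
  proof -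
    have "quiet (state_of l (\<lambda>i. 2 * f i)) (state_of (Suc (Suc l)) ((\<lambda>i. 2 * f i)
        (0 := 2 * f 0 - 1, l := 2 * f l + 1, Suc l := 0, Suc (Suc l) := 0)))"
      using quiet_zero[of l "\<lambda>i. 2 * f i"] l f by simp
    also have "state_of (Suc (Suc l)) ((\<lambda>i. 2 * f i)
        (0 := 2 * f 0 - 1, l := 2 * f l + 1, Suc l := 0, Suc (Suc l) := 0))
        = down (Suc (Suc l)) (2 * f 0 - 2 ^ l) ?b (2 ^ l - 1)"
      unfolding down_def using l f by (intro state_of_cong) (auto simp: CK)
    finally show ?thesis .
  qed
  also have "quiet\<^sup>*\<^sup>* (down (Suc (Suc l)) (2 * f 0 - 2 ^ l) ?b (2 ^ l - 1))
      (down (Suc (Suc l)) (2 * f 0 - 2 ^ l) ?b (2 * ?m + 1))"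
    by (rule down_run) (use l f0 in \<open>auto simp: pow\<close>)
  also have "quiet (down (Suc (Suc l)) (2 * f 0 - 2 ^ l) ?b (2 * ?m + 1))
      (up (Suc l) (2 ^ (l - 1) + 2 * f 1 - 1) (half_cycle l f) ?m)"
  proof -
    let ?a = "\<lambda>i. if i = 0 then 2 * f 0 - 2 ^ l + (2 * ?m + 1) else ?b i - flips (i - 1) (2 * ?m + 1)"
    have "quiet (down (Suc (Suc l)) (2 * f 0 - 2 ^ l) ?b (2 * ?m + 1)) (state_of (Suc l) (\<lambda>i. ?a (Suc i)))"
      unfolding down_def by (rule quiet_halve) (simp add: pow)
    moreover have "state_of (Suc l) (\<lambda>i. ?a (Suc i))
        = up (Suc l) (2 ^ (l - 1) + 2 * f 1 - 1) (half_cycle l f) ?m"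
      unfolding up_def
    proof (rule state_of_cong)
      fix i
      have "2 * half_flips l 1 = 2 ^ (l - 1)"
        using l by (auto simp: half_flips_def simp flip: power_Suc)
      thus "?a (Suc i) = (if i = 0 then 2 ^ (l - 1) + 2 * f 1 - 1 - ?m
          else half_cycle l f i + flips (i - 1) ?m)"
        by (cases i) (use flips_0_odd[of ?m] flips_odd[of "i - 1" ?m] in \<open>auto simp: half_cycle_def\<close>)
    qed
    ultimately show ?thesis by simp
  qed
  finally show ?thesis .
qed

text \<open>The upward run has last entry -1 at \<open>2 * n\<close> with
  \<open>n = 2 ^ (l - 2) + f 1\<close>. Halve leaves \<open>n\<close>, and the run down to 0 ends in
  an all-even state. The bound on \<open>n\<close> keeps the upward run clear of Overflow;
  \<open>half_next l f 0 \<ge> 0\<close> keeps the last run clear of a further Halve.\<close>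

lemma full_cycle:
  assumes l: "l \<ge> 2" and f: "\<And>i. i > l \<Longrightarrow> f i = 0" "f (l - 1) \<noteq> 0"
    and f0: "0 \<le> f 0" "f 0 < 2 ^ (l - 1)" and f1: "0 \<le> f 1" "2 ^ (l - 2) + f 1 < 2 ^ l"
    and half_next: "half_next l f 0 \<ge> 0"
  shows "quiet\<^sup>*\<^sup>* (state_of l (\<lambda>i. 2 * f i)) (state_of l (\<lambda>i. 2 * half_next l f i))"
proof -
  let ?b = "half_cycle l f" and ?s = "2 ^ (l - 1) + 2 * f 1 - 1"
  let ?n = "2 ^ (l - 2) + f 1"
  let ?b' = "\<lambda>i. 2 * half_next l f i"
  have pow: "(2::int) ^ (l - 1) = 2 * 2 ^ (l - 2)"
    using l by (metis Suc_diff_le diff_Suc_Suc numeral_2_eq_2 One_nat_def power_Suc)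
  have pow': "(2::int) ^ l = 2 * 2 ^ (l - 1)"
    using l by (simp flip: power_Suc)
  have odd_s: "odd ?s" using l by simp
  note reach_half_cycle[OF l f f0 f1(1)]
  also have "quiet\<^sup>*\<^sup>* (up (Suc l) ?s ?b (2 ^ (l - 1) - 1 - f 0)) (up (Suc l) ?s ?b (2 * ?n))"
    by (rule up_run[OF odd_s]) (use f0 f1 in \<open>auto simp: half_cycle_def pow[simplified] pow'[simplified]\<close>)
  also have "quiet (up (Suc l) ?s ?b (2 * ?n)) (down l (2 * half_next l f 0) ?b' ?n)"
  proof -
    let ?a = "\<lambda>i. if i = 0 then ?s - 2 * ?n else ?b i + flips (i - 1) (2 * ?n)"
    have "quiet (up (Suc l) ?s ?b (2 * ?n)) (state_of l (\<lambda>i. ?a (Suc i)))"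
      unfolding up_def by (rule quiet_halve) (simp add: pow[simplified])
    moreover have "state_of l (\<lambda>i. ?a (Suc i)) = down l (2 * half_next l f 0) ?b' ?n"
      unfolding down_def
    proof (rule state_of_cong)
      fix i
      show "?a (Suc i) = (if i = 0 then 2 * half_next l f 0 + ?n else ?b' i - flips (i - 1) ?n)"
        by (cases i) (use flips_0_even[of ?n] flips_even[of "i - 1" ?n] in \<open>auto simp: half_cycle_def half_next_def numeral_2_eq_2\<close>)
    qed
    ultimately show ?thesis by simp
  qed
  also have "quiet\<^sup>*\<^sup>* (down l (2 * half_next l f 0) ?b' ?n) (down l (2 * half_next l f 0) ?b' 0)"
    by (rule down_run) (use f1 half_next in auto)
  also have "down l (2 * half_next l f 0) ?b' 0 = state_of l ?b'"
    unfolding down_def by (rule state_of_cong) auto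
  finally show ?thesis .
qed

section \<open>The fixed point of the cycle and its Overflow\<close>

text \<open>For \<open>l = 2 * k + 1\<close> these are the halves of the entries of
  \<open>S_state k\<close>.\<close>

definition half_start :: "nat \<Rightarrow> nat \<Rightarrow> int" where
  "half_start l i = (if 1 \<le> i \<and> i < l then 2 ^ (l - 1 - i) else 0)"

text \<open>For odd \<open>l\<close> the deficit against \<open>half_start\<close> is what a descent
  through the odd positions from \<open>l - 2\<close> to 1, followed by one more raise of entry 1,
  makes up.\<close>

definition after_overflow :: "nat \<Rightarrow> nat \<Rightarrow> int" where
  "after_overflow l i = half_start l i - of_bool (odd i \<and> i + 2 \<le> l) - of_bool (i = 1)"

lemma flips_one: "flips j 1 = of_bool (j = 0)"
  using flips_pow2[of j 0] by simp

text \<open>Here \<open>2 ^ (l - 1) - 1 - f 0 = 1\<close> and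
  \<open>2 ^ (l - 2) + f 1 = 2 ^ l\<close>, so the fixed-point equation at \<open>j - 2\<close>
  expresses the left side at \<open>j\<close> through \<open>f (j - 2)\<close>. The recursion starts
  from \<open>f 0\<close> and \<open>f 1\<close>, hence the dependence on parity.\<close>

lemma fixed_point_entries:
  assumes l: "l \<ge> 3"
    and f0: "f 0 = 2 ^ (l - 1) - 2" and f1: "f 1 = 3 * 2 ^ (l - 2)"
    and half_next: "\<And>i. i \<le> l \<Longrightarrow> half_next l f i = f i"
  shows "2 \<le> j \<Longrightarrow> j \<le> Suc l \<Longrightarrow> f j + half_flips l j = 2 ^ (Suc l - j) - of_bool (even j)"
proof (induction j rule: less_induct)
  case (less j)
  obtain m where m: "l = m + 3"
    using l by (metis add.commute le_Suc_ex)
  have y: "2 ^ (l - 2) + f 1 = 2 ^ l"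
    unfolding f1 by (simp add: m power_add)
  have "half_next l f (j - 2) = f (j - 2)"
    using less.prems by (intro half_next) simp
  hence fj: "f j + half_flips l j = f (j - 2) + of_bool (j = 2) - (if j = 2 then 0 else flips (j - 3) (2 ^ l))"
    using less.prems y by (auto simp: half_next_def f0 flips_one numeral_3_eq_3 numeral_2_eq_2 Suc_diff_Suc split: if_splits)
  consider "j = 2" | "j = 3" | "j \<ge> 4" using less.prems by linarith
  thus ?case
  proof cases
    case 1
    thus ?thesis using fj by (simp add: f0 m)
  next
    case 2
    thus ?thesis using fj f1 by (simp add: flips_pow2 m)
  next
    case 3
    then obtain i where i: "j = i + 2" "i \<ge> 2"
      by (metis add_le_cancel_right le_add_diff_inverse2 less.prems(1) numeral_Bit0)
    then obtain d where d: "l = i + d + 1"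
      using less.prems by (metis Suc_eq_plus1 Suc_le_mono add_2_eq_Suc' le_Suc_ex add_Suc)
    have "f i + half_flips l i = 2 ^ (d + 2) - of_bool (even i)"
      using less.IH[of i] i d by simp
    moreover have "half_flips l i = 2 ^ d" by (simp add: half_flips_def d)
    moreover have "flips (j - 3) (2 ^ l) = 2 * 2 ^ d"
      using i by (simp add: flips_pow2 d Suc_diff_le flip: power_Suc)
    ultimately show ?thesis using fj i by (simp add: d)
  qed
qed

text \<open>The last entry would become -1 only at \<open>2 ^ Suc l\<close>, which needs one bit too
  many. The run stops at \<open>2 ^ Suc l - 1\<close> with last entry 0, where the leading entry
  alone is odd.\<close>

lemma overflow_cycle:
  assumes l: "l \<ge> 3" and f: "\<And>i. i > l \<Longrightarrow> f i = 0" "f (l - 1) \<noteq> 0"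
    and f0: "f 0 = 2 ^ (l - 1) - 2" and f1: "f 1 = 3 * 2 ^ (l - 2)"
    and half_next: "\<And>i. i \<le> l \<Longrightarrow> half_next l f i = f i"
  obtains X where "quiet\<^sup>*\<^sup>* (state_of l (\<lambda>i. 2 * f i)) X" "rule_at X = Overflow"
    "successor X = Some (state_of (l + 2) (\<lambda>i. 2 * after_overflow (l + 2) i))"
proof
  let ?b = "half_cycle l f" and ?s = "2 ^ (l - 1) + 2 * f 1 - 1"
  let ?n = "2 ^ Suc l - 1"
  let ?a = "\<lambda>i. if i = 0 then ?s - ?n else ?b i + flips (i - 1) ?n"
  obtain m where m: "l = m + 3"
    using l by (metis add.commute le_Suc_ex)
  have s: "?s = 2 ^ Suc l - 1"
    unfolding f1 by (simp add: m power_add)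
  have n: "2 ^ (l - 1) - 1 - f 0 = 1" by (simp add: f0)
  have pow: "(4::int) \<le> 2 ^ (l - 1)" by (simp add: m power_add)
  have "quiet\<^sup>*\<^sup>* (state_of l (\<lambda>i. 2 * f i)) (up (Suc l) ?s ?b 1)"
    using reach_half_cycle[of l f] l f f0 f1 pow n by simp
  also have "quiet\<^sup>*\<^sup>* (up (Suc l) ?s ?b 1) (up (Suc l) ?s ?b ?n)"
    by (rule up_run) (unfold s, use one_less_power[of "2::int" "Suc l"] in \<open>auto simp: half_cycle_def\<close>)
  finally show "quiet\<^sup>*\<^sup>* (state_of l (\<lambda>i. 2 * f i)) (state_of (Suc l) ?a)"
    unfolding up_def .
  have a: "?a i = 2 * (2 ^ (Suc l - i) - of_bool (odd i) - of_bool (i = 1))"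
    if i: "1 \<le> i" "i \<le> l" for i
  proof -
    obtain d where d: "l = i + d" using le_Suc_ex[OF i(2)] by blast
    have "f (Suc i) + half_flips l (Suc i) = 2 ^ d - of_bool (odd i)"
      using fixed_point_entries[OF l f0 f1 half_next, of "Suc i"] that by (simp add: d)
    moreover have "flips (i - 1) (2 ^ (l - 1) - 1 - f 0) = of_bool (i = 1)"
      using that unfolding n flips_one by auto
    ultimately have "?b i = 2 * (2 ^ d - of_bool (odd i) - of_bool (i = 1))"
      unfolding half_cycle_def by simp
    moreover have "flips (i - 1) ?n = 2 * 2 ^ d"
      unfolding flips_pow2_minus_1 using that by (simp add: d)
    moreover have "(2::int) ^ (Suc l - i) = 2 * 2 ^ d" by (simp add: d)
    ultimately show ?thesis using that by simp
  qed
  have top: "?a (Suc l) = 1"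
    using l f(1) unfolding half_cycle_def n flips_one flips_pow2_minus_1 by (simp add: half_flips_def)
  have zero: "?a 0 = 0" using s by simp
  have even: "even (?a i)" if "i < Suc l" for i
    using a[of i] zero that by (cases "i = 0") simp_all
  have ov: "odd (?a (Suc l))" using top by simp
  show "rule_at (state_of (Suc l) ?a) = Overflow"
    by (rule overflow(1)[of "Suc l" ?a, OF _ ov even]) simp_all
  have "successor (state_of (Suc l) ?a)
      = Some (state_of (Suc (Suc l)) (?a(Suc l := ?a (Suc l) + 1, Suc (Suc l) := 0)))"
    by (rule overflow(2)[of "Suc l" ?a, OF _ ov even]) simp_all
  also have "state_of (Suc (Suc l)) (?a(Suc l := ?a (Suc l) + 1, Suc (Suc l) := 0))
      = state_of (l + 2) (\<lambda>i. 2 * after_overflow (l + 2) i)"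
    unfolding add_2_eq_Suc'
  proof (rule state_of_cong)
    fix i assume "i \<le> Suc (Suc l)"
    then consider "i = 0" | "1 \<le> i" "i \<le> l" | "i = Suc l" | "i = Suc (Suc l)"
      by linarith
    thus "(?a(Suc l := ?a (Suc l) + 1, Suc (Suc l) := 0)) i = 2 * after_overflow (Suc (Suc l)) i"
    proof cases
      case 2
      thus ?thesis using a[OF 2] by (simp add: after_overflow_def half_start_def)
    qed (use top zero l in \<open>simp_all add: after_overflow_def half_start_def\<close>)
  qed
  finally show "successor (state_of (Suc l) ?a) = Some (state_of (l + 2) (\<lambda>i. 2 * after_overflow (l + 2) i))" .
qed

section \<open>Descent of the raised position\<close>

definition bump :: "nat \<Rightarrow> (nat \<Rightarrow> int) \<Rightarrow> nat \<Rightarrow> int" where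
  "bump p f i = f i + of_bool (i = p)"

definition bump_chain :: "nat \<Rightarrow> (nat \<Rightarrow> int) \<Rightarrow> nat \<Rightarrow> int" where
  "bump_chain p f i = f i + of_bool (i \<le> p \<and> even (p - i))"

text \<open>Entries other than \<open>f 0\<close> and \<open>f 1\<close> enter
  \<open>half_next\<close> only through the shift by two, which comes from the two uses of
  Halve.\<close>

lemma half_next_bump_ge_2:
  assumes "half_next l f = bump p f" "p \<ge> 2"
  shows "half_next l (bump p f) = bump (p - 2) (bump p f)"
proof
  fix i
  have "half_next l (bump p f) i = half_next l f i + of_bool (i = p - 2)"
    using assms(2) by (auto simp: half_next_def bump_def)
  thus "half_next l (bump p f) i = bump (p - 2) (bump p f) i"
    by (simp add: assms(1) bump_def)
qed

text \<open>Raising \<open>f 1\<close> raises the starting number of the last downward run by one.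
  The extra flip is at the bit given by its valuation, which sits one entry higher.\<close>

lemma half_next_bump_1:
  assumes "half_next l f = bump 1 f" "2 ^ (l - 2) + f 1 + 1 \<noteq> 0"
  shows "half_next l (bump 1 f) = bump (Suc (v2 (2 ^ (l - 2) + f 1 + 1))) (bump 1 f)"
proof
  fix i
  show "half_next l (bump 1 f) i = bump (Suc (v2 (2 ^ (l - 2) + f 1 + 1))) (bump 1 f) i"
    using fun_cong[OF assms(1), of i] flips_diff[OF assms(2), of "i - 1"]
    by (auto simp: half_next_def bump_def add.assoc)
qed

text \<open>Raising \<open>f 0\<close> lowers the number left by the first Halve by one. Its flips
  are subtracted, so the entry at its valuation gains one.\<close>

lemma half_next_bump_0:
  assumes "half_next l f = bump 0 f" "f 0 \<noteq> 2 ^ (l - 1) - 1"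
  shows "half_next l (bump 0 f) = bump (v2 (2 ^ (l - 1) - 1 - f 0)) (bump 0 f)"
proof
  fix i
  have "2 ^ (l - 1) - 1 - f 0 \<noteq> 0" using assms(2) by simp
  from flips_diff[OF this, of i]
  show "half_next l (bump 0 f) i = bump (v2 (2 ^ (l - 1) - 1 - f 0)) (bump 0 f) i"
    using fun_cong[OF assms(1), of i] by (auto simp: half_next_def bump_def algebra_simps)
qed

text \<open>Positivity of \<open>f (l - 1)\<close> excludes Halt and, unlike being nonzero, survives
  every bump.\<close>

definition regular :: "nat \<Rightarrow> (nat \<Rightarrow> int) \<Rightarrow> bool" where
  "regular l f \<longleftrightarrow> (\<forall>i>l. f i = 0) \<and> f (l - 1) > 0 \<and> f 0 \<ge> 0 \<and> f 1 \<ge> 0"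

lemma regular_bump: "regular l f \<Longrightarrow> p \<le> l \<Longrightarrow> regular l (bump p f)"
  by (auto simp: regular_def bump_def)

lemma bump_cycle:
  assumes "l \<ge> 2" "regular l f" "half_next l f = bump p f"
    "f 0 < 2 ^ (l - 1)" "2 ^ (l - 2) + f 1 < 2 ^ l"
  shows "quiet\<^sup>*\<^sup>* (state_of l (\<lambda>i. 2 * f i)) (state_of l (\<lambda>i. 2 * bump p f i))"
proof -
  have "half_next l f 0 \<ge> 0"
    using assms(2) by (simp add: assms(3) bump_def regular_def)
  thus ?thesis
    using full_cycle[of l f] assms by (simp add: regular_def)
qed

text \<open>While \<open>p \<ge> 2\<close> the entries 0 and 1 do not change, so the bounds persist
  and \<open>p\<close> falls by 2 per cycle. The last cycle raises entry 1 or entry 0, and the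
  valuation gives the next \<open>p\<close>.\<close>

lemma chain_cycle:
  assumes "l \<ge> 2"
  shows "regular l f \<Longrightarrow> half_next l f = bump p f \<Longrightarrow> p \<le> l \<Longrightarrow>
    f 0 < 2 ^ (l - 1) \<Longrightarrow> 2 ^ (l - 2) + f 1 < 2 ^ l \<Longrightarrow>
    quiet\<^sup>*\<^sup>* (state_of l (\<lambda>i. 2 * f i)) (state_of l (\<lambda>i. 2 * bump_chain p f i)) \<and>
    regular l (bump_chain p f) \<and>
    (odd p \<longrightarrow> half_next l (bump_chain p f) = bump (Suc (v2 (2 ^ (l - 2) + f 1 + 1))) (bump_chain p f)) \<and>
    (even p \<longrightarrow> f 0 \<noteq> 2 ^ (l - 1) - 1 \<longrightarrow>
      half_next l (bump_chain p f) = bump (v2 (2 ^ (l - 1) - 1 - f 0)) (bump_chain p f))"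
proof (induction p arbitrary: f rule: less_induct)
  case (less p)
  note step = bump_cycle[OF assms less.prems(1,2,4,5)]
  have pos: "2 ^ (l - 2) + f 1 + 1 \<noteq> 0"
  proof -
    have "(0::int) < 2 ^ (l - 2)" by simp
    moreover have "f 1 \<ge> 0" using less.prems(1) by (simp add: regular_def)
    ultimately show ?thesis by linarith
  qed
  consider "p = 0" | "p = 1" | "p \<ge> 2" by linarith
  thus ?case
  proof cases
    case 1
    have "bump_chain p f = bump p f"
      by (auto simp: fun_eq_iff bump_def bump_chain_def 1)
    thus ?thesis
      using step half_next_bump_0[of l f] less.prems regular_bump[of l f p] by (simp add: 1)
  next
    case 2
    have "bump_chain p f = bump p f"
      by (auto simp: fun_eq_iff bump_def bump_chain_def 2 le_Suc_eq)
    thus ?thesis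
      using step half_next_bump_1[of l f] pos less.prems regular_bump[of l f p] by (simp add: 2)
  next
    case 3
    have chain: "bump_chain p f = bump_chain (p - 2) (bump p f)"
    proof
      fix i
      obtain q where q: "p = Suc (Suc q)"
        using 3 by (intro that[of "p - 2"]) simp
      consider "i \<le> q" | "i = Suc q" | "i = p" | "i > p"
        using q by linarith
      thus "bump_chain p f i = bump_chain (p - 2) (bump p f) i"
        by cases (simp_all add: bump_def bump_chain_def q Suc_diff_le)
    qed
    have "bump p f 0 = f 0" "bump p f 1 = f 1"
      using 3 by (auto simp: bump_def)
    moreover have "even p \<longleftrightarrow> even (p - 2)" using 3 by simp
    ultimately show ?thesis
      using less.IH[of "p - 2" "bump p f"] 3 less.prems step
        half_next_bump_ge_2[OF less.prems(2) 3] regular_bump[of l f p]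
      unfolding chain by (auto intro: rtranclp_trans)
  qed
qed

section \<open>The race of \<open>g\<close> and \<open>h\<close> to the fixed point\<close>

lemma v2_pow2_shift:
  assumes "0 < x" "x < 2 ^ m"
  shows "v2 (2 ^ m + x) = v2 x" "v2 (2 ^ m - x) = v2 x"
proof -
  have "v2 x < m" using assms by (rule v2_less)
  then obtain d where d: "m = Suc (v2 x + d)" using less_iff_Suc_add by auto
  obtain t where t: "x = 2 ^ v2 x * (2 * t + 1)"
    using assms by (elim v2_decompose[of x, rotated]) simp
  have "2 ^ m + x = 2 ^ v2 x * (2 * (2 ^ d + t) + 1)"
    by (subst t) (simp add: d power_add algebra_simps)
  thus "v2 (2 ^ m + x) = v2 x" by (rule v2_eqI) simp
  have "2 ^ m - x = 2 ^ v2 x * (2 * (2 ^ d - t) - 1)"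
    by (subst t) (simp add: d power_add algebra_simps)
  thus "v2 (2 ^ m - x) = v2 x" by (rule v2_eqI) simp
qed

lemma v2_odd: "odd n \<Longrightarrow> v2 n = 0"
  by (rule v2_eqI[of _ 0 n]) auto

text \<open>An odd \<open>p\<close> descends to 1 and raises \<open>g\<close>; an even \<open>p\<close> descends to 0 and raises \<open>h\<close>.\<close>

lemma main_loop:
  assumes l: "odd l" "l \<ge> 3"
  shows "regular l f \<Longrightarrow> half_next l f = bump p f \<Longrightarrow> p \<le> l \<Longrightarrow> f 0 = h \<Longrightarrow> f 1 = 2 ^ (l - 2) + g \<Longrightarrow>
    0 \<le> h \<Longrightarrow> h \<le> g \<Longrightarrow> g < 2 ^ (l - 1) \<Longrightarrow>
    (odd p \<Longrightarrow> (h = 0 \<or> odd (v2 h)) \<and> (\<forall>x. h < x \<longrightarrow> x \<le> g \<longrightarrow> even (v2 x))) \<Longrightarrow>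
    (even p \<Longrightarrow> odd (v2 g) \<and> h < g \<and> (\<forall>x. h < x \<longrightarrow> x < g \<longrightarrow> even (v2 x))) \<Longrightarrow>
    \<exists>f'. quiet\<^sup>*\<^sup>* (state_of l (\<lambda>i. 2 * f i)) (state_of l (\<lambda>i. 2 * f' i)) \<and> regular l f' \<and>
      f' 0 = 2 ^ (l - 1) - 2 \<and> f' 1 = 3 * 2 ^ (l - 2) \<and> (\<forall>i\<le>l. half_next l f' i = f' i)"
\<comment> \<open>While \<open>p\<close> is odd, \<open>g\<close> advances past numbers of even
  valuation. Once it hits an odd valuation, \<open>p\<close> becomes even and \<open>h\<close>
  advances; the next number of odd valuation above \<open>h\<close> is \<open>g\<close> itself, so
  \<open>h\<close> catches up exactly there and \<open>p\<close> becomes odd again.\<close>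
proof (induction "nat (2 * 2 ^ (l - 1) - g - h)" arbitrary: f p g h rule: less_induct)
  case less
  note prems = less.prems
  let ?f = "bump_chain p f"
  obtain m where m: "l = m + 3"
    using l by (metis add.commute le_Suc_ex)
  define M :: int where "M = 2 ^ (l - 1)"
  have M: "2 ^ (l - 1) = M" "2 ^ (l - 2) + (2 ^ (l - 2) + g) + 1 = M + (g + 1)"
    "(2::int) ^ l = 2 * M" "2 ^ (l - 2) + M = 3 * 2 ^ (l - 2)"
    by (simp_all add: M_def m power_add)
  have gM: "g < M" using prems(8) by (simp add: M_def)
  have bound: "2 ^ (l - 2) + f 1 < 2 ^ l"
    using gM M(2) unfolding prems(5) M(3) by linarith
  have "f 0 < 2 ^ (l - 1)" using gM prems(4,7) by (simp add: M(1)[simplified])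
  note chain = chain_cycle[OF _ prems(1-3) this bound]
  have reach: "quiet\<^sup>*\<^sup>* (state_of l (\<lambda>i. 2 * f i)) (state_of l (\<lambda>i. 2 * ?f i))" and reg: "regular l ?f"
    using chain l by simp_all
  show ?case
  proof (cases "odd p")
    case True
    have f': "?f 0 = h" "?f 1 = 2 ^ (l - 2) + (g + 1)"
      using True prems(4,5) odd_pos[OF True] by (auto simp: bump_chain_def)
    have half_next: "half_next l ?f = bump (Suc (v2 (M + (g + 1)))) ?f"
      using chain True l unfolding prems(5) M(2) by simp
    note inv = prems(9)[OF True]
    show ?thesis
    proof (cases "g + 1 = M")
      case True
      \<comment> \<open>The next position would be \<open>l + 1\<close>, outside the state, so
        nothing changes up to index \<open>l\<close>.\<close>
      have "v2 (M + (g + 1)) = l"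
        using v2_pow2[of l] unfolding True M(3) by simp
      hence "\<forall>i\<le>l. half_next l ?f i = ?f i"
        by (simp add: half_next bump_def)
      \<comment> \<open>\<open>h\<close> is the last number of odd valuation up to
        \<open>M - 1\<close>; \<open>M - 2\<close> has valuation 1 and \<open>M - 1\<close> has
        valuation 0.\<close>
      moreover have "h = M - 2"
      proof -
        have "v2 (M - 2) = 1"
          by (rule v2_eqI[of _ 1 "2 ^ Suc m - 1"]) (simp_all add: M_def m)
        moreover have "v2 (M - 1) = 0"
          by (rule v2_odd) (simp add: M_def m)
        moreover have "M \<ge> 4" by (simp add: M_def m power_add)
        ultimately show ?thesis
          using inv prems(6,7) True by (smt (verit) even_zero odd_one)
      qed
      ultimately show ?thesis
        using reach reg f' M True by (intro exI[of _ ?f]) simp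
    next
      case False
      hence g: "g + 1 < M" using gM by simp
      have v: "v2 (M + (g + 1)) = v2 (g + 1)"
        using v2_pow2_shift(1)[of "g + 1" "l - 1"] prems(6,7) g by (simp add: M_def)
      have "v2 (g + 1) < l - 1"
        using v2_less[of "g + 1" "l - 1"] prems(6,7) g by (simp add: M_def)
      hence q: "Suc (v2 (g + 1)) \<le> l" by simp
      have "\<exists>f'. quiet\<^sup>*\<^sup>* (state_of l (\<lambda>i. 2 * ?f i)) (state_of l (\<lambda>i. 2 * f' i)) \<and> regular l f' \<and>
        f' 0 = 2 ^ (l - 1) - 2 \<and> f' 1 = 3 * 2 ^ (l - 2) \<and> (\<forall>i\<le>l. half_next l f' i = f' i)"
      proof (rule less.hyps[OF _ reg half_next[unfolded v] q f'])
        show "nat (2 * 2 ^ (l - 1) - (g + 1) - h) < nat (2 * 2 ^ (l - 1) - g - h)"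
          using gM prems(7) by (simp add: M(1)[simplified])
      next
        assume "odd (Suc (v2 (g + 1)))"
        thus "(h = 0 \<or> odd (v2 h)) \<and> (\<forall>x. h < x \<longrightarrow> x \<le> g + 1 \<longrightarrow> even (v2 x))"
          using inv by (smt (verit) even_Suc)
      qed (use prems(6,7) g inv in \<open>auto simp: M(1)[simplified]\<close>)
      thus ?thesis using reach by (meson rtranclp_trans)
    qed
  next
    case False
    hence inv: "odd (v2 g)" "h < g" "\<And>x. h < x \<Longrightarrow> x < g \<Longrightarrow> even (v2 x)"
      using prems(10) by auto
    have f': "?f 0 = h + 1" "?f 1 = 2 ^ (l - 2) + g"
      using False prems(4,5) by (auto simp: bump_chain_def)
    have v: "v2 (M - 1 - h) = v2 (h + 1)"
      using v2_pow2_shift(2)[of "h + 1" "l - 1"] prems(6) inv(2) gM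
      by (simp add: M_def algebra_simps)
    have "v2 (h + 1) < l - 1"
      using v2_less[of "h + 1" "l - 1"] prems(6) inv(2) gM by (simp add: M_def)
    hence q: "v2 (h + 1) \<le> l" by simp
    have half_next: "half_next l ?f = bump (v2 (h + 1)) ?f"
      using chain False l inv(2) gM unfolding prems(4) M(1) v by simp
    have "\<exists>f'. quiet\<^sup>*\<^sup>* (state_of l (\<lambda>i. 2 * ?f i)) (state_of l (\<lambda>i. 2 * f' i)) \<and> regular l f' \<and>
      f' 0 = 2 ^ (l - 1) - 2 \<and> f' 1 = 3 * 2 ^ (l - 2) \<and> (\<forall>i\<le>l. half_next l f' i = f' i)"
    proof (rule less.hyps[OF _ reg half_next q f'])
      show "nat (2 * 2 ^ (l - 1) - g - (h + 1)) < nat (2 * 2 ^ (l - 1) - g - h)"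
        using gM inv(2) by (simp add: M(1)[simplified])
    next
      assume "odd (v2 (h + 1))"
      thus "(h + 1 = 0 \<or> odd (v2 (h + 1))) \<and> (\<forall>x. h + 1 < x \<longrightarrow> x \<le> g \<longrightarrow> even (v2 x))"
        using inv by (smt (verit))
    next
      assume "even (v2 (h + 1))"
      thus "odd (v2 g) \<and> h + 1 < g \<and> (\<forall>x. h + 1 < x \<longrightarrow> x < g \<longrightarrow> even (v2 x))"
        using inv by (smt (verit))
    qed (use prems(6) gM inv in \<open>auto simp: M(1)[simplified]\<close>)
    thus ?thesis using reach by (meson rtranclp_trans)
  qed
qed

section \<open>Entering the race, and the return after Overflow\<close>

text \<open>This starts the race with \<open>p = l\<close> and \<open>g = h = 0\<close>.\<close>

lemma half_next_start:
  assumes "l \<ge> 3"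
  shows "half_next l (half_start l) = bump l (half_start l)"
proof
  fix i
  obtain m where m: "l = m + 3"
    using assms by (metis add.commute le_Suc_ex)
  have y: "2 ^ (l - 2) + half_start l 1 = 2 ^ (l - 1)" and x: "2 ^ (l - 1) - 1 - half_start l 0 = 2 ^ (l - 1) - 1"
    by (simp_all add: half_start_def m)
  \<comment> \<open>The closed forms with truncated exponents change near
    \<open>i = l\<close>.\<close>
  consider "i = 0" | d where "i \<ge> 1" "l = i + d + 3" | "i \<ge> 1" "l = i + 2" | "l = i + 1" | "l = i" | "i > l"
  proof -
    have "i = 0 \<or> (i \<ge> 1 \<and> (\<exists>d. l = i + d + 3)) \<or> (i \<ge> 1 \<and> l = i + 2) \<or> l = i + 1 \<or> l = i \<or> i > l"
      by presburger
    thus ?thesis using that by blast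
  qed
  thus "half_next l (half_start l) i = bump l (half_start l) i"
    unfolding half_next_def bump_def y x flips_pow2 flips_pow2_minus_1
  proof cases
    case (2 d)
    thus "half_start l (i + 2) + half_flips l (i + 2) - (if i < l - 1 then 2 ^ (l - 1 - 1 - i) else 0)
      + (if i = 0 then 0 else if i - 1 < l - 1 then 2 ^ (l - 1 - 1 - (i - 1)) else of_bool (i - 1 = l - 1))
      = half_start l i + of_bool (i = l)"
      by (simp add: half_start_def half_flips_def)
  qed (use m in \<open>auto simp: half_start_def half_flips_def\<close>)
qed

text \<open>The first chain descends from \<open>l - 2\<close> to 1. The next position is then 1
  again, because \<open>2 ^ (l - 1) - 1\<close> is odd, and one more cycle reaches
  \<open>half_start\<close>.\<close>

lemma after_overflow_cycle:
  assumes l: "odd l" "l \<ge> 5"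
  shows "quiet\<^sup>*\<^sup>* (state_of l (\<lambda>i. 2 * after_overflow l i)) (state_of l (\<lambda>i. 2 * half_start l i))"
proof -
  let ?f = "after_overflow l"
  let ?f' = "bump_chain (l - 2) ?f"
  let ?M = "2 ^ (l - 1) :: int"
  obtain m where m: "l = Suc (Suc (Suc (Suc (Suc m))))"
    using l by (intro that[of "l - 5"]) simp
  have f0: "?f 0 = 0" and f1: "2 ^ (l - 2) + ?f 1 = ?M - 2"
    using l by (simp_all add: after_overflow_def half_start_def m power_add)
  have half_start: "half_start l 0 = 0" "2 ^ (l - 2) + half_start l 1 = ?M"
    by (simp_all add: half_start_def m)
  have M: "?M \<ge> 16" "(2::int) ^ l = 2 * ?M" by (simp_all add: m power_add)
  have reg: "regular l ?f"
  proof -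
    have "?M = 2 * 2 ^ (l - 2)" by (simp add: m)
    hence "?f 1 \<ge> 0" using f1 M(1) by linarith
    moreover have "?f (l - 1) = 1" "\<forall>i>l. ?f i = 0"
      using l by (auto simp: after_overflow_def half_start_def m)
    ultimately show ?thesis by (simp add: regular_def f0)
  qed
  have "half_next l ?f = bump (l - 2) ?f"
  proof
    fix i
    have v: "v2 (?M - 1) = 0" by (rule v2_odd) (simp add: m)
    \<comment> \<open>\<open>half_start\<close> has \<open>?M\<close> in place of
      \<open>?M - 2\<close>, so the two images differ by the flips at \<open>?M\<close> and
      \<open>?M - 1\<close>.\<close>
    have flips: "flips j (?M - 2) = flips j ?M - of_bool (j = l - 1) - of_bool (j = 0)" for j
      using flips_diff[of ?M j] flips_diff[of "?M - 1" j] M(1) v l by simp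
    have "half_next l ?f i = half_next l (half_start l) i - of_bool (odd i \<and> i + 4 \<le> l) - of_bool (i = 1) - of_bool (i = l)"
      unfolding half_next_def f0 f1 half_start flips using l by (auto simp: after_overflow_def)
    also have "\<dots> = bump (l - 2) ?f i"
      using l by (auto simp: half_next_start bump_def after_overflow_def) presburger+
    finally show "half_next l ?f i = bump (l - 2) ?f i" .
  qed
  note chain = chain_cycle[OF _ reg this]
  have "v2 (?M - 2 + 1) = 0" by (rule v2_odd) (simp add: m)
  hence chain': "quiet\<^sup>*\<^sup>* (state_of l (\<lambda>i. 2 * ?f i)) (state_of l (\<lambda>i. 2 * ?f' i))"
    "regular l ?f'" "half_next l ?f' = bump 1 ?f'"
    using chain l M by (simp_all add: f0 f1[simplified])
  have half_start': "bump 1 ?f' = half_start l"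
    using l by (auto simp: fun_eq_iff bump_def bump_chain_def after_overflow_def half_start_def m)
  have "?f' 0 = 0" "?f' 1 = ?f 1 + 1"
    using l f0 by (auto simp: bump_chain_def)
  hence "quiet\<^sup>*\<^sup>* (state_of l (\<lambda>i. 2 * ?f' i)) (state_of l (\<lambda>i. 2 * bump 1 ?f' i))"
    using bump_cycle[of l ?f' 1] chain' l M f1 by simp
  thus ?thesis using chain'(1) unfolding half_start' by (rule rtranclp_trans[rotated])
qed

section \<open>Counting Overflows and uniqueness of the passage\<close>

lemma S_state_eq: "S_state k = state_of (2 * k + 1) (\<lambda>i. 2 * half_start (2 * k + 1) i)"
proof (rule nth_equalityI)
  fix i assume "i < length (S_state k)"
  hence i: "i \<le> 2 * k + 1" by (simp add: S_state_def del: upt_Suc)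
  consider "i = 0" | j where "i = Suc j" "j < 2 * k" | "i = 2 * k + 1"
    using i by (cases i) (auto simp: le_less)
  thus "S_state k ! i = state_of (2 * k + 1) (\<lambda>i. 2 * half_start (2 * k + 1) i) ! i"
  proof cases
    case (2 j)
    hence "2 * k - j = Suc (2 * k - Suc j)" by simp
    thus ?thesis
      using 2 by (simp add: S_state_def nth_state_of half_start_def nth_append del: upt_Suc)
  qed (simp_all add: S_state_def nth_state_of half_start_def nth_append del: upt_Suc)
qed (simp add: S_state_def del: upt_Suc)

lemma iterate_add: "iterate (i + j) S = Option.bind (iterate i S) (iterate j)"
  by (induction j) (auto simp: bind_assoc split: Option.bind_split)

lemma iterate_quiet:
  assumes "quiet\<^sup>*\<^sup>* S T"
  shows "\<exists>j. iterate j S = Some T \<and> count_list (rules_applied j S) Overflow = 0"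
  using assms
proof (induction rule: rtranclp_induct)
  case base
  show ?case by (rule exI[of _ 0]) (simp add: rules_applied_def)
next
  case (step T U)
  then obtain j where "iterate j S = Some T" "count_list (rules_applied j S) Overflow = 0"
    by blast
  thus ?case
    using step.hyps(2) by (intro exI[of _ "Suc j"]) (auto simp: rules_applied_def quiet_def)
qed

lemma rules_applied_add:
  assumes "iterate i S = Some T"
  shows "rules_applied (i + j) S = rules_applied i S @ rules_applied j T"
  by (induction j) (simp_all add: rules_applied_def iterate_add assms)

lemma S_state_step:
  assumes "k \<ge> 1"
  shows "\<exists>j. iterate j (S_state k) = Some (S_state (k + 1)) \<and>
    count_list (rules_applied j (S_state k)) Overflow = 1"
proof -
  let ?l = "2 * k + 1"
  have l: "?l \<ge> 3" using assms by simp
  have half_start: "regular ?l (half_start ?l)" "half_start ?l 0 = 0" "half_start ?l 1 = 2 ^ (?l - 2) + 0"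
    using assms by (auto simp: regular_def half_start_def)
  obtain f where f: "quiet\<^sup>*\<^sup>* (state_of ?l (\<lambda>i. 2 * half_start ?l i)) (state_of ?l (\<lambda>i. 2 * f i))" "regular ?l f"
      "f 0 = 2 ^ (?l - 1) - 2" "f 1 = 3 * 2 ^ (?l - 2)" "\<forall>i\<le>?l. half_next ?l f i = f i"
  proof -
    have "\<exists>f. quiet\<^sup>*\<^sup>* (state_of ?l (\<lambda>i. 2 * half_start ?l i)) (state_of ?l (\<lambda>i. 2 * f i)) \<and> regular ?l f \<and>
      f 0 = 2 ^ (?l - 1) - 2 \<and> f 1 = 3 * 2 ^ (?l - 2) \<and> (\<forall>i\<le>?l. half_next ?l f i = f i)"
      by (rule main_loop[OF _ l half_start(1) half_next_start[OF l] le_refl half_start(2,3)]) simp_all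
    thus ?thesis using that by blast
  qed
  obtain X where X: "quiet\<^sup>*\<^sup>* (state_of ?l (\<lambda>i. 2 * f i)) X" "rule_at X = Overflow"
      "successor X = Some (state_of (?l + 2) (\<lambda>i. 2 * after_overflow (?l + 2) i))"
    by (rule overflow_cycle[OF l, of f]) (use f in \<open>auto simp: regular_def\<close>)
  have "quiet\<^sup>*\<^sup>* (S_state k) X"
    using f(1) X(1) unfolding S_state_eq by (rule rtranclp_trans)
  then obtain i where i: "iterate i (S_state k) = Some X"
      "count_list (rules_applied i (S_state k)) Overflow = 0"
    using iterate_quiet by blast
  have "quiet\<^sup>*\<^sup>* (state_of (?l + 2) (\<lambda>i. 2 * after_overflow (?l + 2) i)) (S_state (k + 1))"
    using after_overflow_cycle[of "?l + 2"] assms by (simp add: S_state_eq)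
  then obtain j where j: "iterate j (state_of (?l + 2) (\<lambda>i. 2 * after_overflow (?l + 2) i)) = Some (S_state (k + 1))"
      "count_list (rules_applied j (state_of (?l + 2) (\<lambda>i. 2 * after_overflow (?l + 2) i))) Overflow = 0"
    using iterate_quiet by blast
  have Suc_i: "iterate (Suc i) (S_state k) = Some (state_of (?l + 2) (\<lambda>i. 2 * after_overflow (?l + 2) i))"
    using i X(3) by simp
  have "count_list (rules_applied (Suc i) (S_state k)) Overflow = 1"
    using i X(2) by (simp add: rules_applied_def)
  hence "count_list (rules_applied (Suc i + j) (S_state k)) Overflow = 1"
    unfolding rules_applied_add[OF Suc_i] using j(2) by simp
  moreover have "iterate (Suc i + j) (S_state k) = Some (S_state (k + 1))"
    unfolding iterate_add Suc_i using j(1) by simp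
  ultimately show ?thesis by blast
qed

lemma S_state_reaches:
  assumes "k \<ge> 1"
  shows "\<exists>j\<ge>m. iterate j (S_state k) = Some (S_state (k + m))"
proof (induction m)
  case 0
  show ?case by (rule exI[of _ 0]) simp
next
  case (Suc m)
  then obtain i where i: "i \<ge> m" "iterate i (S_state k) = Some (S_state (k + m))"
    by blast
  obtain j where j: "iterate j (S_state (k + m)) = Some (S_state (k + m + 1))"
      "count_list (rules_applied j (S_state (k + m))) Overflow = 1"
    using S_state_step[of "k + m"] assms by auto
  \<comment> \<open>The one Overflow shows that each passage takes at least one step, so the total
    time is unbounded.\<close>
  have "j \<noteq> 0" using j(2) by (intro notI) (simp add: rules_applied_def)
  thus ?case
    using i j(1) by (intro exI[of _ "i + j"]) (simp add: iterate_add)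
qed

text \<open>A return after \<open>d\<close> steps would confine the orbit to \<open>d\<close>
  states, of length at most \<open>m\<close>; but the orbit contains \<open>S_state (k + m)\<close>,
  which is longer than \<open>m\<close>.\<close>

lemma S_state_not_periodic:
  assumes "k \<ge> 1" "d > 0"
  shows "iterate d (S_state k) \<noteq> Some (S_state k)"
proof
  let ?S = "S_state k"
  assume d: "iterate d ?S = Some ?S"
  have multiple: "iterate (q * d) ?S = Some ?S" for q
    by (induction q) (simp_all add: iterate_add d)
  define m where "m = Max ((\<lambda>i. length (the (iterate i ?S))) ` {..<d})"
  obtain j where j: "iterate j ?S = Some (S_state (k + m))"
    using S_state_reaches[OF assms(1)] by blast
  have "iterate j ?S = iterate (j div d * d + j mod d) ?S" by simp
  also have "\<dots> = iterate (j mod d) ?S"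
    unfolding iterate_add multiple by simp
  finally have "length (S_state (k + m)) = length (the (iterate (j mod d) ?S))"
    unfolding j by (metis option.sel)
  also have "\<dots> \<le> m"
    unfolding m_def using assms(2) by (intro Max_ge) auto
  finally show False by (simp add: S_state_eq)
qed

theorem theorem1p3:
  "(\<forall>k\<ge>1. S_state k \<mapsto> S_state (k + 1) \<and>
      (\<forall>j. iterate j (S_state k) = Some (S_state (k + 1)) \<longrightarrow>
        count_list (rules_applied j (S_state k)) Overflow = 1)) \<and>
   S_state 1 = [0, 2, 4, 0] \<and>
   (\<forall>j. iterate j (S_state 1) \<noteq> None)"
proof (intro conjI allI impI)
  fix k :: nat assume k: "k \<ge> 1"
  obtain i where i: "iterate i (S_state k) = Some (S_state (k + 1))"
      "count_list (rules_applied i (S_state k)) Overflow = 1"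
    using S_state_step[OF k] by blast
  show "S_state k \<mapsto> S_state (k + 1)"
    using i(1) by (auto simp: leads_to_def)
  fix j assume j: "iterate j (S_state k) = Some (S_state (k + 1))"
  \<comment> \<open>Two different arrival times would make the orbit of
    \<open>S_state (k + 1)\<close> periodic. So the time is unique and the count holds for every
    \<open>j\<close>.\<close>
  have no_later: "\<not> a < b" if "iterate a (S_state k) = Some (S_state (k + 1))"
    "iterate b (S_state k) = Some (S_state (k + 1))" for a b
  proof
    assume "a < b"
    then obtain d where "b = a + d" "d > 0" by (metis less_imp_add_positive)
    hence "iterate d (S_state (k + 1)) = Some (S_state (k + 1))"
      using that by (simp add: iterate_add)
    thus False using S_state_not_periodic[of "k + 1" d] \<open>d > 0\<close> by simp
  qed
  have "i = j" using no_later[OF i(1) j] no_later[OF j i(1)] by simp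
  thus "count_list (rules_applied j (S_state k)) Overflow = 1" using i(2) by simp
next
  show "S_state 1 = [0, 2, 4, 0]"
    by (simp add: S_state_def upt_rec)
next
  fix j
  obtain i where "i \<ge> j" "iterate i (S_state 1) = Some (S_state (1 + j))"
    using S_state_reaches[of 1 j] by auto
  thus "iterate j (S_state 1) \<noteq> None"
    \<comment> \<open>An undefined iterate stays undefined, while a later one is defined.\<close>
    using iterate_add[of j "i - j" "S_state 1"] by (cases "iterate j (S_state 1)") auto
qed

end
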